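(* Let $k\ge 1$ and $n$ be integers with $2k+1\le n$. Let $Q_{n,k}$ be the word $$Q_{n,k} := s_{n-k-1}\cdots s_1\ \ s_{n-k-1}\cdots s_2\ \ \cdots\ \ s_{n-k-1}s_{n-k-2}\ \ s_{n-k-1}$$ in the simple transpositions $s_i=(i,i+1)$ of $\mathfrak{S}_{n-k}$ (a reduced word for the longest element $[n-k,\ldots,1]$ of $\mathfrak{S}_{n-k}$), and let $Q'_{n,k}$ be the word obtained from $Q_{n,k}$ by deleting all letters $s_i$ with $1\le i\le k$. Let $$\pi_{n,k}:=[1,\ldots,k,\,n-k,\,n-k-1,\ldots,k+1]\in\mathfrak{S}_{n-k}$$ (one-line notation). Then $\Delta_{n,k}=\Delta(Q'_{n,k},\pi_{n,k})$, where the vertices of the two complexes are identified as follows: the letters of $Q'_{n,k}$ are in bijection with $\Gamma_{n,k}$, the letter corresponding to the diagonal $\overline{ij}$ ($i<j$) being $s_{n-j+i}$, and the letters of $Q'_{n,k}$ listed from left to right correspond to the diagonals of $\Gamma_{n,k}$ ordered by decreasing $j$ (from $j=n$ downward) and, for fixed $j$, by decreasing $i$.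
   Context: Label the vertices of a convex $n$-gon by $1,\ldots,n$ in cyclic order, and write $\overline{ij}$ for the segment joining $i$ and $j$. Set $\Gamma_{n,k}:=\{\overline{ij}: k<|i-j|<n-k\}$. A $(k+1)$-crossing is a set of $k+1$ diagonals which mutually cross (in their interiors). A $k$-triangulation is a maximal subset of $\Gamma_{n,k}$ containing no $(k+1)$-crossing. $\Delta_{n,k}$ is the simplicial complex on vertex set $\Gamma_{n,k}$ whose facets are the $k$-triangulations (faces are subsets of $k$-triangulations). For a word $Q=w_1\cdots w_r$ in the simple transpositions of a symmetric group and a permutation $\pi$, the subword complex $\Delta(Q,\pi)$ is the simplicial complex on the vertex set of positions $\{1,\ldots,r\}$ of $Q$ (distinct positions are distinct vertices even if the letters coincide) whose facets are the sets of positions whose complement (as a subword of $Q$) is a reduced word for $\pi$; equivalently a set of positions is a face iff its complementary subword contains a reduced word for $\pi$. *)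

theory Defs
  imports Main
begin

text \<open>Diagonals of the convex n-gon with vertices 1..n are pairs (i,j) with i < j.\<close>

definition Gamma :: "nat \<Rightarrow> nat \<Rightarrow> (nat \<times> nat) set" where
  "Gamma n k = {(i, j). 1 \<le> i \<and> i < j \<and> j \<le> n \<and> k < j - i \<and> j - i < n - k}"

definition crosses :: "nat \<times> nat \<Rightarrow> nat \<times> nat \<Rightarrow> bool" where
  "crosses d e = (case d of (a, b) \<Rightarrow> case e of (c, d') \<Rightarrow>
      (a < c \<and> c < b \<and> b < d') \<or> (c < a \<and> a < d' \<and> d' < b))"

definition is_crossing :: "nat \<Rightarrow> (nat \<times> nat) set \<Rightarrow> bool" where
  "is_crossing m C = (finite C \<and> card C = m \<and> (\<forall>d\<in>C. \<forall>e\<in>C. d \<noteq> e \<longrightarrow> crosses d e))"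

definition crossing_free :: "nat \<Rightarrow> (nat \<times> nat) set \<Rightarrow> bool" where
  "crossing_free k S = (\<not> (\<exists>C \<subseteq> S. is_crossing (k + 1) C))"

definition k_triangulation :: "nat \<Rightarrow> nat \<Rightarrow> (nat \<times> nat) set \<Rightarrow> bool" where
  "k_triangulation n k T = (T \<subseteq> Gamma n k \<and> crossing_free k T \<and>
     (\<forall>T'. T \<subseteq> T' \<and> T' \<subseteq> Gamma n k \<and> crossing_free k T' \<longrightarrow> T' = T))"

definition Delta_faces :: "nat \<Rightarrow> nat \<Rightarrow> (nat \<times> nat) set set" where
  "Delta_faces n k = {F. \<exists>T. k_triangulation n k T \<and> F \<subseteq> T}"

definition stp :: "nat \<Rightarrow> nat \<Rightarrow> nat" where
  "stp a x = (if x = a then a + 1 else if x = a + 1 then a else x)"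

fun word_prod :: "nat list \<Rightarrow> nat \<Rightarrow> nat" where
  "word_prod [] = id"
| "word_prod (a # w) = stp a \<circ> word_prod w"

definition is_word :: "nat \<Rightarrow> nat list \<Rightarrow> bool" where
  "is_word m w = (\<forall>a\<in>set w. 1 \<le> a \<and> a < m)"

definition reduced_word :: "nat \<Rightarrow> nat list \<Rightarrow> (nat \<Rightarrow> nat) \<Rightarrow> bool" where
  "reduced_word m w \<pi> = (is_word m w \<and> word_prod w = \<pi> \<and>
     (\<forall>w'. is_word m w' \<and> word_prod w' = \<pi> \<longrightarrow> length w \<le> length w'))"

definition subword_faces :: "nat \<Rightarrow> nat list \<Rightarrow> (nat \<Rightarrow> nat) \<Rightarrow> nat set set" where
  "subword_faces m Q \<pi> = {I. I \<subseteq> {0..<length Q} \<and>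
     (\<exists>J. J \<subseteq> {0..<length Q} - I \<and> reduced_word m (nths Q J) \<pi>)}"

definition Q_word :: "nat \<Rightarrow> nat \<Rightarrow> nat list" where
  "Q_word n k = concat (map (\<lambda>a. rev [a..<n - k]) [1..<n - k])"

definition Q'_word :: "nat \<Rightarrow> nat \<Rightarrow> nat list" where
  "Q'_word n k = filter (\<lambda>i. \<not> (1 \<le> i \<and> i \<le> k)) (Q_word n k)"

text \<open>\<pi>_{n,k} = [1,...,k, n-k, n-k-1, ..., k+1] in one-line notation, identity outside 1..n-k.\<close>
definition pi_nk :: "nat \<Rightarrow> nat \<Rightarrow> nat \<Rightarrow> nat" where
  "pi_nk n k x = (if k < x \<and> x \<le> n - k then n + 1 - x else x)"

definition diag_list :: "nat \<Rightarrow> nat \<Rightarrow> (nat \<times> nat) list" where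
  "diag_list n k = concat (map (\<lambda>j. filter (\<lambda>d. d \<in> Gamma n k) (map (\<lambda>i. (i, j)) (rev [1..<j])))
                             (rev [1..<n + 1]))"

end

theory Submission
  imports Defs
begin

text \<open>
  Write \<open>h\<^sub>p(x)\<close> for the number of positions \<open>y \<le> x\<close> at which the one-line notation of the current
  permutation has a value exceeding \<open>p\<close>. Read the word from left to right and multiply greedily,
  that is, use an available letter \<open>s\<^sub>l\<close> exactly when it creates an inversion. Then \<open>h\<^sub>p(l)\<close> is
  replaced by \<open>min (h\<^sub>p(l - 1) + 1) (h\<^sub>p(l + 1))\<close>. This is the recursion of a longest chain problem:
  after the letters of the diagonals with larger endpoint at least \<open>j\<close>, the value of \<open>h\<^sub>p\<close> at
  \<open>n - j + i\<close> is the number of these rows minus the size of a largest set of mutually crossing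
  unavailable diagonals in \<open>{i..p} \<times> {j..n}\<close>. Hence the greedy product is \<open>\<pi>\<close> iff for no \<open>p\<close>
  there are \<open>k + 1\<close> mutually crossing unavailable diagonals in \<open>{1..p} \<times> {p+1..n}\<close>. Segments
  outside \<open>\<Gamma>\<close> may be counted as unavailable, since they never belong to a \<open>(k+1)\<close>-crossing.
\<close>

section \<open>Crossings\<close>

lemma crosses_sym: "crosses d e \<longleftrightarrow> crosses e d"
  by (auto simp: crosses_def split: prod.splits)

lemma is_crossing_subset:
  assumes "is_crossing m C" "C' \<subseteq> C"
  shows "is_crossing (card C') C'"
  using assms unfolding is_crossing_def by (meson finite_subset subsetD)

lemma finite_Gamma: "finite (Gamma n k)"
proof (rule finite_subset)
  show "Gamma n k \<subseteq> {..n} \<times> {..n}" by (auto simp: Gamma_def)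
qed simp

text \<open>\<open>Gamma n k\<close> is finite, so a crossing-free subset always extends to a
  maximal one. From here on only crossing-freeness matters, not maximality.\<close>

lemma Delta_faces_eq: "Delta_faces n k = {F. F \<subseteq> Gamma n k \<and> crossing_free k F}"
proof (intro equalityI subsetI)
  fix F assume "F \<in> Delta_faces n k"
  then show "F \<in> {F. F \<subseteq> Gamma n k \<and> crossing_free k F}"
    by (fastforce simp: Delta_faces_def k_triangulation_def crossing_free_def)
next
  fix F assume F: "F \<in> {F. F \<subseteq> Gamma n k \<and> crossing_free k F}"
  have "finite {F. F \<subseteq> Gamma n k \<and> crossing_free k F}"
    using finite_Gamma[of n k] by simp
  from finite_has_maximal2[OF this F] obtain T where T:
    "T \<subseteq> Gamma n k" "crossing_free k T" "F \<subseteq> T"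
    "\<And>T'. T' \<subseteq> Gamma n k \<Longrightarrow> crossing_free k T' \<Longrightarrow> T \<subseteq> T' \<Longrightarrow> T = T'"
    by auto
  have "k_triangulation n k T"
    unfolding k_triangulation_def
  proof (intro conjI allI impI)
    show "T' = T" if "T \<subseteq> T' \<and> T' \<subseteq> Gamma n k \<and> crossing_free k T'" for T'
      using T(4)[of T'] that by simp
  qed (use T in auto)
  then show "F \<in> Delta_faces n k" using T(3) by (auto simp: Delta_faces_def)
qed

text \<open>Each of the k other members crosses (a, b), so it has one endpoint strictly between a
  and b and one strictly outside. Crossing diagonals share no endpoint, so each side contains k
  distinct vertices.\<close>

lemma crossing_subset_Gamma:
  assumes C: "is_crossing (k + 1) C"
    and bounds: "\<And>a b. (a, b) \<in> C \<Longrightarrow> 1 \<le> a \<and> a < b \<and> b \<le> n"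
  shows "C \<subseteq> Gamma n k"
proof clarify
  fix a b assume ab: "(a, b) \<in> C"
  define B where "B = C - {(a, b)}"
  have card_B: "card B = k" using C ab by (auto simp: B_def is_crossing_def)
  have B: "crosses (a, b) e" if "e \<in> B" for e
    using that C ab by (auto simp: B_def is_crossing_def)
  have BB: "crosses d e" if "d \<in> B" "e \<in> B" "d \<noteq> e" for d e
    using that C by (auto simp: B_def is_crossing_def)
  \<comment> \<open>\<open>f\<close> picks the endpoint strictly between a and b, \<open>g\<close>
    the endpoint outside.\<close>
  define f where "f = (\<lambda>(c, d). if a < c \<and> c < b then c else d)"
  define g where "g = (\<lambda>(c, d). if a < c \<and> c < b then d else c)"
  have inj_f: "inj_on f B"
  proof (rule inj_onI, rule ccontr)
    fix d e assume *: "d \<in> B" "e \<in> B" "f d = f e" "d \<noteq> e"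
    then show False using BB[of d e] B[of d] B[of e]
      by (auto simp: f_def crosses_def split: prod.splits if_splits)
  qed
  have inj_g: "inj_on g B"
  proof (rule inj_onI, rule ccontr)
    fix d e assume *: "d \<in> B" "e \<in> B" "g d = g e" "d \<noteq> e"
    then show False using BB[of d e] B[of d] B[of e]
      by (auto simp: g_def crosses_def split: prod.splits if_splits)
  qed
  have f: "f ` B \<subseteq> {a<..<b}"
    using B by (fastforce simp: f_def crosses_def)
  have g: "g ` B \<subseteq> {1..n} - {a..b}"
  proof
    fix x assume "x \<in> g ` B"
    then obtain c d where cd: "(c, d) \<in> B" "x = g (c, d)" by auto
    then have "1 \<le> c" "c < d" "d \<le> n" using bounds[of c d] by (auto simp: B_def)
    then show "x \<in> {1..n} - {a..b}"
      using cd B[of "(c, d)"] by (auto simp: g_def crosses_def)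
  qed
  have "k \<le> b - a - 1"
    using card_mono[OF _ f] card_image[OF inj_f] card_B by simp
  moreover have "k \<le> n - (b + 1 - a)"
    using card_mono[OF _ g] card_image[OF inj_g] card_B bounds[OF ab]
      card_Diff_subset[of "{a..b}" "{1..n}"] by simp
  ultimately show "(a, b) \<in> Gamma n k"
    using bounds[OF ab] by (auto simp: Gamma_def)
qed

text \<open>Let p be the largest of the smaller endpoints. Its diagonal crosses all others, so their
  larger endpoints lie beyond p; the k + 1 distinct smaller endpoints in 1..p give
  \<open>k < p\<close>.\<close>

lemma crossing_in_rectangle:
  assumes C: "is_crossing (k + 1) C"
    and bounds: "\<And>a b. (a, b) \<in> C \<Longrightarrow> 1 \<le> a \<and> a < b \<and> b \<le> n"
  obtains p where "C \<subseteq> {1..p} \<times> {p+1..n}" "k < p" "p \<le> n"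
proof -
  define p where "p = Max (fst ` C)"
  have fin: "finite C" and ne: "C \<noteq> {}"
    using C by (auto simp: is_crossing_def)
  have pin: "p \<in> fst ` C" unfolding p_def using fin ne by (intro Max_in) auto
  then obtain q where q: "(p, q) \<in> C" by auto
  have le: "a \<le> p" if "(a, b) \<in> C" for a b
    unfolding p_def using fin that by (intro Max_ge) (auto intro: rev_image_eqI)
  have gt: "p < b" if "(a, b) \<in> C" for a b
  proof (cases "(a, b) = (p, q)")
    case True then show ?thesis using bounds[OF q] by simp
  next
    case False
    then have "crosses (a, b) (p, q)" using C that q by (auto simp: is_crossing_def)
    then show ?thesis using le[OF that] by (auto simp: crosses_def)
  qed
  have sub: "C \<subseteq> {1..p} \<times> {p+1..n}" using le gt bounds by fastforce
  have "inj_on fst C"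
  proof (rule inj_onI, rule ccontr)
    fix d e assume "d \<in> C" "e \<in> C" "fst d = fst e" "d \<noteq> e"
    then show False using C by (fastforce simp: is_crossing_def crosses_def)
  qed
  moreover have "fst ` C \<subseteq> {1..p}" using sub by auto
  ultimately have "card C \<le> p" using card_inj_on_le[of fst C "{1..p}"] by simp
  then have "k < p" using C by (simp add: is_crossing_def)
  with sub bounds[OF q] show ?thesis by (intro that[of p]) auto
qed

function chain :: "nat \<Rightarrow> nat \<Rightarrow> (nat \<times> nat) set \<Rightarrow> nat \<Rightarrow> nat \<Rightarrow> nat" where
  "chain n p A i j = (if p < i \<or> n < j then 0
     else if (i, j) \<in> A then max (chain n p A (i + 1) j) (chain n p A i (j + 1))
     else 1 + chain n p A (i + 1) (j + 1))"
  by pat_completeness auto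
termination by (relation "measure (\<lambda>(n, p, A, i, j). (p + 1 - i) + (n + 1 - j))") auto

declare chain.simps [simp del]

lemma chain_outside: "p < i \<or> n < j \<Longrightarrow> chain n p A i j = 0"
  by (simp add: chain.simps)

lemma chain_available:
  "i \<le> p \<Longrightarrow> j \<le> n \<Longrightarrow> (i, j) \<in> A \<Longrightarrow>
    chain n p A i j = max (chain n p A (i + 1) j) (chain n p A i (j + 1))"
  by (subst chain.simps) simp

lemma chain_unavailable:
  "i \<le> p \<Longrightarrow> j \<le> n \<Longrightarrow> (i, j) \<notin> A \<Longrightarrow> chain n p A i j = 1 + chain n p A (i + 1) (j + 1)"
  by (subst chain.simps) simp

lemma crossing_of_chain:
  assumes "p < j"
  shows "\<exists>C \<subseteq> {i..p} \<times> {j..n} - A. is_crossing (chain n p A i j) C"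
  using assms
proof (induction n p A i j rule: chain.induct)
  case (1 n p A i j)
  consider "p < i \<or> n < j" | "i \<le> p" "j \<le> n" "(i, j) \<in> A"
      "chain n p A i j = chain n p A (i + 1) j"
    | "i \<le> p" "j \<le> n" "(i, j) \<in> A" "chain n p A i j = chain n p A i (j + 1)"
    | "i \<le> p" "j \<le> n" "(i, j) \<notin> A"
    using chain.simps[of n p A i j] by (auto simp: max_def not_less split: if_splits)
  then show ?case
  proof cases
    case 1
    then have "chain n p A i j = 0" by (rule chain_outside)
    then show ?thesis by (intro exI[of _ "{}"]) (simp add: is_crossing_def)
  next
    case 2
    then obtain C where "C \<subseteq> {i+1..p} \<times> {j..n} - A" "is_crossing (chain n p A (i+1) j) C"
      using "1.IH"(1) "1.prems" by auto
    moreover have "{i+1..p} \<times> {j..n} - A \<subseteq> {i..p} \<times> {j..n} - A" by auto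
    ultimately show ?thesis using 2(4) by (metis subset_trans)
  next
    case 3
    then obtain C where "C \<subseteq> {i..p} \<times> {j+1..n} - A" "is_crossing (chain n p A i (j+1)) C"
      using "1.IH"(2) "1.prems" by auto
    moreover have "{i..p} \<times> {j+1..n} - A \<subseteq> {i..p} \<times> {j..n} - A" by auto
    ultimately show ?thesis using 3(4) by (metis subset_trans)
  next
    case 4
    then obtain C where C: "C \<subseteq> {i+1..p} \<times> {j+1..n} - A"
      "is_crossing (chain n p A (i+1) (j+1)) C"
      using "1.IH"(3) "1.prems" by auto
    \<comment> \<open>Here \<open>p < j\<close> enters: for e = (c, d) one has i < c \<le> p < j <
      d.\<close>
    have new: "crosses (i, j) e" if "e \<in> C" for e
      using C(1) that "1.prems" by (auto simp: crosses_def)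
    have "(i, j) \<notin> C" using C(1) by auto
    then have "is_crossing (chain n p A i j) (insert (i, j) C)"
      using C(2) 4 new crosses_sym by (auto simp: is_crossing_def chain_unavailable)
    moreover have "insert (i, j) C \<subseteq> {i..p} \<times> {j..n} - A" using C(1) 4 by auto
    ultimately show ?thesis by blast
  qed
qed

lemma crossing_le_chain:
  assumes "p < j" "C \<subseteq> {i..p} \<times> {j..n} - A" "is_crossing m C"
  shows "m \<le> chain n p A i j"
  using assms
proof (induction n p A i j arbitrary: C m rule: chain.induct)
  case (1 n p A i j)
  have comp: "fst d < fst e \<and> snd d < snd e \<or> fst e < fst d \<and> snd e < snd d"
    if "d \<in> C" "e \<in> C" "d \<noteq> e" for d e
  proof -
    have "crosses d e" using that "1.prems"(3) by (auto simp: is_crossing_def)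
    then show ?thesis by (auto simp: crosses_def split: prod.splits)
  qed
  consider "p < i \<or> n < j" | "i \<le> p" "j \<le> n" "(i, j) \<in> A"
    | "i \<le> p" "j \<le> n" "(i, j) \<notin> A" by linarith
  then show ?case
  proof cases
    case 1
    then have "C = {}" using "1.prems"(2) by auto
    then show ?thesis using "1.prems"(3) by (simp add: is_crossing_def)
  next
    case 2
    \<comment> \<open>Otherwise one member has first coordinate i and one has second coordinate j.
      They differ because the corner lies in \<open>A\<close>, yet they cannot be strictly ordered
      in both coordinates.\<close>
    have "C \<subseteq> {i+1..p} \<times> {j..n} - A \<or> C \<subseteq> {i..p} \<times> {j+1..n} - A"
    proof (rule ccontr)
      assume "\<not> ?thesis"
      then obtain d e where de: "d \<in> C" "e \<in> C" "d \<notin> {i+1..p} \<times> {j..n} - A"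
        "e \<notin> {i..p} \<times> {j+1..n} - A" by auto
      have in_C: "d \<in> {i..p} \<times> {j..n} - A" "e \<in> {i..p} \<times> {j..n} - A"
        using de(1,2) "1.prems"(2) by blast+
      have d: "fst d = i" "j \<le> snd d" using in_C(1) de(3) by (cases d; simp)+
      have e: "snd e = j" "i \<le> fst e" using in_C(2) de(4) by (cases e; simp)+
      have "d \<noteq> e" using in_C(1) 2(3) d(1) e(1) by (cases d) auto
      then show False using comp[OF de(1,2)] d e by simp
    qed
    then show ?thesis
      using "1.IH"(1)[of C m] "1.IH"(2)[of C m] "1.prems" 2
      by (auto simp: chain_available)
  next
    case 3
    show ?thesis
    proof (cases "C = {}")
      case True
      then show ?thesis using "1.prems"(3) by (simp add: is_crossing_def)
    next
      case False
      have fin: "finite C" using "1.prems"(3) by (simp add: is_crossing_def)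
      \<comment> \<open>The member with least first coordinate is also least in the second. Removing
        it, whether or not it is the corner, leaves a crossing in the smaller rectangle.\<close>
      have "Min (fst ` C) \<in> fst ` C" using fin False by (intro Min_in) auto
      then obtain d where d: "d \<in> C" "fst d = Min (fst ` C)" by auto
      have min: "fst d \<le> fst e" if "e \<in> C" for e using d(2) fin that by simp
      have "C - {d} \<subseteq> {i+1..p} \<times> {j+1..n} - A"
      proof
        fix e assume e: "e \<in> C - {d}"
        then have "fst d < fst e" "snd d < snd e"
          using comp[of d e] d(1) min[of e] by auto
        then show "e \<in> {i+1..p} \<times> {j+1..n} - A"
          using subsetD[OF "1.prems"(2) d(1)] subsetD[OF "1.prems"(2), of e] e
          by (cases d; cases e) auto
      qed
      moreover have "is_crossing (m - 1) (C - {d})"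
        using "1.prems"(3) d(1) by (auto simp: is_crossing_def)
      ultimately have "m - 1 \<le> chain n p A (i+1) (j+1)"
        using "1.IH"(3)[of "C - {d}" "m - 1"] "1.prems"(1) 3 by auto
      then show ?thesis using 3 by (simp add: chain_unavailable)
    qed
  qed
qed

text \<open>A chain may use segments outside \<open>Gamma n k\<close>, but k + 1 mutually crossing
  ones always lie in \<open>Gamma n k\<close>, hence in F. Conversely, a (k+1)-crossing fits into
  one of the rectangles.\<close>

lemma crossing_free_iff_chain_le:
  assumes F: "F \<subseteq> Gamma n k"
  shows "crossing_free k F \<longleftrightarrow>
    (\<forall>p. k < p \<and> p \<le> n \<longrightarrow> chain n p (Gamma n k - F) 1 (p + 1) \<le> k)"
proof (intro iffI allI impI)
  fix p assume free: "crossing_free k F" and p: "k < p \<and> p \<le> n"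
  show "chain n p (Gamma n k - F) 1 (p + 1) \<le> k"
  proof (rule ccontr)
    let ?l = "chain n p (Gamma n k - F) 1 (p + 1)"
    assume "\<not> ?l \<le> k"
    obtain C where C: "C \<subseteq> {1..p} \<times> {p+1..n} - (Gamma n k - F)" "is_crossing ?l C"
      using crossing_of_chain[of p "p + 1" 1 n "Gamma n k - F"] by auto
    then have "k + 1 \<le> card C" using \<open>\<not> ?l \<le> k\<close> by (simp add: is_crossing_def)
    then obtain C' where C': "C' \<subseteq> C" "card C' = k + 1"
      by (meson obtain_subset_with_card_n)
    then have cr: "is_crossing (k + 1) C'" using is_crossing_subset[OF C(2)] by metis
    have "C' \<subseteq> Gamma n k"
    proof (rule crossing_subset_Gamma[OF cr])
      show "1 \<le> a \<and> a < b \<and> b \<le> n" if "(a, b) \<in> C'" for a b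
        using that C'(1) C(1) by fastforce
    qed
    then have "C' \<subseteq> F" using C'(1) C(1) by auto
    then show False using cr free by (auto simp: crossing_free_def)
  qed
next
  assume le: "\<forall>p. k < p \<and> p \<le> n \<longrightarrow> chain n p (Gamma n k - F) 1 (p + 1) \<le> k"
  show "crossing_free k F"
    unfolding crossing_free_def
  proof clarify
    fix C assume C: "C \<subseteq> F" "is_crossing (k + 1) C"
    have "1 \<le> a \<and> a < b \<and> b \<le> n" if "(a, b) \<in> C" for a b
      using that C(1) F by (auto simp: Gamma_def)
    from crossing_in_rectangle[OF C(2) this] obtain p
      where p: "C \<subseteq> {1..p} \<times> {p+1..n}" "k < p" "p \<le> n" by blast
    then have "k + 1 \<le> chain n p (Gamma n k - F) 1 (p + 1)"
      using C by (intro crossing_le_chain[of p "p + 1" C]) auto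
    then show False using le p(2,3) by fastforce
  qed
qed

section \<open>Heights and inversions of one-line notation\<close>

fun height :: "nat \<Rightarrow> (nat \<Rightarrow> nat) \<Rightarrow> nat \<Rightarrow> int" where
  "height p \<sigma> 0 = 0"
| "height p \<sigma> (Suc x) = height p \<sigma> x + (if p < \<sigma> (Suc x) then 1 else 0)"

lemma height_cong: "(\<And>y. 1 \<le> y \<Longrightarrow> y \<le> x \<Longrightarrow> \<sigma> y = \<tau> y) \<Longrightarrow> height p \<sigma> x = height p \<tau> x"
  by (induction x) auto

lemma height_id: "height p id x = int (x - p)"
  by (induction x) auto

lemma height_le_diff: "(\<And>y. 1 \<le> y \<Longrightarrow> y \<le> k \<Longrightarrow> \<sigma> y \<le> p) \<Longrightarrow> height p \<sigma> x \<le> int (x - k)"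
proof (induction x)
  case (Suc x)
  then have "height p \<sigma> x \<le> int (x - k)" by blast
  moreover have "\<sigma> (Suc x) \<le> p" if "Suc x \<le> k" using that Suc.prems by simp
  ultimately show ?case by (cases "Suc x \<le> k") (auto simp: not_le)
qed simp

text \<open>Only positions after k contribute, each at most 1, so attaining the upper bound forces
  all of them to contribute.\<close>

lemma height_full:
  assumes "\<And>y. 1 \<le> y \<Longrightarrow> y \<le> k \<Longrightarrow> \<sigma> y \<le> p" "height p \<sigma> x \<ge> int (x - k)" "k < y" "y \<le> x"
  shows "p < \<sigma> y"
  using assms(2-4)
proof (induction x)
  case (Suc x)
  have "height p \<sigma> x \<le> int (x - k)" using assms(1) by (rule height_le_diff)
  moreover have "int (Suc x - k) = int (x - k) + 1" using Suc.prems by simp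
  ultimately have "p < \<sigma> (Suc x)" "height p \<sigma> x \<ge> int (x - k)"
    using Suc.prems(1) by (auto split: if_splits)
  then show ?case using Suc by (cases "y = Suc x") auto
qed simp

text \<open>Swapping the entries at positions a and a + 1 alters the contents of no prefix except
  the one of length a.\<close>

lemma height_stp:
  assumes "1 \<le> a"
  shows "height p (\<sigma> \<circ> stp a) =
    (height p \<sigma>)(a := height p \<sigma> (a - 1) + (if p < \<sigma> (a + 1) then 1 else 0))"
proof
  fix x
  obtain b where a: "a = Suc b" using assms by (cases a) auto
  have below: "height p (\<sigma> \<circ> stp a) x = height p \<sigma> x" if "x < a" for x
    using that by (intro height_cong) (auto simp: stp_def)
  have above: "height p (\<sigma> \<circ> stp a) (a + 1 + c) = height p \<sigma> (a + 1 + c)" for c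
    using below[of b] by (induction c) (auto simp: a stp_def)
  consider "x < a" | "x = a" | c where "x = a + 1 + c"
    by (metis Suc_eq_plus1 Suc_leI le_Suc_ex linorder_neqE_nat)
  then show "height p (\<sigma> \<circ> stp a) x =
      ((height p \<sigma>)(a := height p \<sigma> (a - 1) + (if p < \<sigma> (a + 1) then 1 else 0))) x"
  proof cases
    case 2
    then show ?thesis using below[of b] by (simp add: a stp_def)
  qed (use below above in auto)
qed

section \<open>Inversions and the length of words\<close>

definition inversions :: "nat \<Rightarrow> (nat \<Rightarrow> nat) \<Rightarrow> (nat \<times> nat) set" where
  "inversions m \<sigma> = {(x, y). x < y \<and> y \<le> m \<and> \<sigma> y < \<sigma> x}"

lemma finite_inversions: "finite (inversions m \<sigma>)"
proof (rule finite_subset)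
  show "inversions m \<sigma> \<subseteq> {..m} \<times> {..m}" by (auto simp: inversions_def)
qed simp

lemma stp_stp [simp]: "stp a (stp a x) = x"
  by (simp add: stp_def)

lemma inj_stp: "inj (stp a)"
  by (metis injI stp_stp)

text \<open>\<open>stp a\<close> preserves the order of every pair of positions except (a, a + 1).
  Hence it carries the old inversions injectively to new ones, and (a, a + 1) is the only
  addition.\<close>

lemma card_inversions_ascent:
  assumes "a < m" "\<sigma> a < \<sigma> (a + 1)"
  shows "card (inversions m (\<sigma> \<circ> stp a)) = card (inversions m \<sigma>) + 1"
proof -
  let ?f = "map_prod (stp a) (stp a)"
  have ff: "?f (?f z) = z" for z by (cases z) simp
  have less: "stp a x < stp a y" if "x < y" "(x, y) \<noteq> (a, a + 1)" for x y
    using that by (auto simp: stp_def)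
  have le: "stp a y \<le> m" if "y \<le> m" for y
    using that assms(1) by (auto simp: stp_def)
  have "inversions m (\<sigma> \<circ> stp a) = insert (a, a + 1) (?f ` inversions m \<sigma>)"
  proof (intro equalityI subsetI)
    fix z assume z: "z \<in> inversions m (\<sigma> \<circ> stp a)"
    show "z \<in> insert (a, a + 1) (?f ` inversions m \<sigma>)"
    proof (cases "z = (a, a + 1)")
      case False
      then have "?f z \<in> inversions m \<sigma>"
        using z by (cases z) (auto simp: inversions_def intro: less le)
      then show ?thesis by (metis ff image_eqI insertI2)
    qed simp
  next
    fix z assume z: "z \<in> insert (a, a + 1) (?f ` inversions m \<sigma>)"
    show "z \<in> inversions m (\<sigma> \<circ> stp a)"
    proof (cases "z = (a, a + 1)")
      case True
      then show ?thesis using assms by (simp add: inversions_def stp_def)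
    next
      case False
      then obtain x y where xy: "(x, y) \<in> inversions m \<sigma>" "z = (stp a x, stp a y)"
        using z by auto
      then have "(x, y) \<noteq> (a, a + 1)" using assms(2) by (auto simp: inversions_def)
      then show ?thesis using xy by (auto simp: inversions_def intro: less le)
    qed
  qed
  moreover have "(a, a + 1) \<notin> ?f ` inversions m \<sigma>"
  proof
    assume "(a, a + 1) \<in> ?f ` inversions m \<sigma>"
    then obtain z where z: "z \<in> inversions m \<sigma>" "?f z = (a, a + 1)" by force
    then have "z = ?f (a, a + 1)" by (metis ff)
    then show False using z(1) by (simp add: inversions_def stp_def)
  qed
  moreover have "inj_on ?f (inversions m \<sigma>)" by (rule inj_on_inverseI[of _ ?f]) (rule ff)
  ultimately show ?thesis by (simp add: card_image finite_inversions)
qed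

lemma word_prod_append: "word_prod (v @ w) = word_prod v \<circ> word_prod w"
  by (induction v) auto

lemma inj_word_prod: "inj (word_prod w)"
  by (induction w) (auto intro: inj_compose inj_stp simp del: o_apply)

lemma word_prod_fixed:
  assumes "\<And>a. a \<in> set w \<Longrightarrow> k < a \<and> a < m" "x \<le> k \<or> m < x"
  shows "word_prod w x = x"
  using assms
proof (induction w)
  case (Cons a w)
  then have "word_prod w x = x" "k < a" "a < m" by auto
  then show ?case using Cons.prems(2) by (auto simp: stp_def)
qed simp

text \<open>Each letter changes the number of inversions by one, up or down. This bound later
  certifies that the greedy word is reduced.\<close>

lemma card_inversions_le_length:
  assumes "\<And>a. a \<in> set w \<Longrightarrow> a < m"
  shows "card (inversions m (word_prod w)) \<le> length w"
  using assms
proof (induction w rule: rev_induct)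
  case Nil
  have "inversions m id = {}" by (auto simp: inversions_def)
  then show ?case by (simp add: id_def)
next
  case (snoc a w)
  let ?\<sigma> = "word_prod w"
  have IH: "card (inversions m ?\<sigma>) \<le> length w" and a: "a < m"
    using snoc by auto
  have eq: "word_prod (w @ [a]) = ?\<sigma> \<circ> stp a" by (simp add: word_prod_append)
  have len: "length (w @ [a]) = length w + 1" by simp
  have "?\<sigma> a \<noteq> ?\<sigma> (a + 1)" using inj_word_prod[of w] by (simp add: inj_eq)
  then consider "?\<sigma> a < ?\<sigma> (a + 1)" | "?\<sigma> (a + 1) < ?\<sigma> a" by linarith
  then show ?case
  proof cases
    case 1
    then show ?thesis unfolding eq len using card_inversions_ascent[OF a 1] IH by linarith
  next
    case 2
    \<comment> \<open>At a descent the swapped permutation has an ascent at a, and swapping back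
      returns the old one, so the ascent lemma applies in reverse.\<close>
    then have "(?\<sigma> \<circ> stp a) a < (?\<sigma> \<circ> stp a) (a + 1)" by (simp add: stp_def)
    from card_inversions_ascent[OF a this]
    have "card (inversions m (?\<sigma> \<circ> stp a \<circ> stp a)) = card (inversions m (?\<sigma> \<circ> stp a)) + 1" .
    moreover have "?\<sigma> \<circ> stp a \<circ> stp a = ?\<sigma>" by (rule ext) simp
    ultimately have "card (inversions m ?\<sigma>) = card (inversions m (?\<sigma> \<circ> stp a)) + 1" by metis
    then show ?thesis unfolding eq len using IH by linarith
  qed
qed

section \<open>Greedy evaluation of a word\<close>

definition letter :: "nat \<Rightarrow> nat \<times> nat \<Rightarrow> nat" where
  "letter n d = n - snd d + fst d"

text \<open>The effect of one greedy step on heights. After it the larger of the two entries stands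
  at position a, swapped or not, and it exceeds p iff at least one of the two does; this is the
  minimum, a formula free of p.\<close>

definition bubble :: "nat \<Rightarrow> (nat \<times> nat) set \<Rightarrow> (nat \<Rightarrow> int) \<Rightarrow> nat \<times> nat \<Rightarrow> nat \<Rightarrow> int" where
  "bubble n A h d = (if d \<in> A
     then h(letter n d := min (h (letter n d - 1) + 1) (h (letter n d + 1))) else h)"

lemma nths_snoc: "nths (xs @ [x]) J = nths xs J @ (if length xs \<in> J then [x] else [])"
  by (simp add: nths_append)

lemma nths_insert_length: "nths xs (insert (length xs) J) = nths xs J"
  unfolding nths_def by (intro arg_cong[of _ _ "map fst"] filter_cong) (auto dest: set_zip_rightD)

text \<open>A letter is taken iff it is available and creates an inversion, so length and inversion
  number grow together. The same subword serves all p at once; \<open>int (x - p)\<close> is the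
  height of the identity.\<close>

lemma greedy_word:
  assumes "\<And>d. d \<in> set D \<Longrightarrow> 1 \<le> letter n d \<and> letter n d < m"
  shows "\<exists>J \<subseteq> {r. r < length D \<and> D ! r \<in> A}. \<exists>w. w = nths (map (letter n) D) J \<and>
    length w = card (inversions m (word_prod w)) \<and>
    (\<forall>p. height p (word_prod w) = foldl (bubble n A) (\<lambda>x. int (x - p)) D)"
  using assms
proof (induction D rule: rev_induct)
  case Nil
  have "inversions m id = {}" by (auto simp: inversions_def)
  then show ?case by (intro exI[of _ "{}"]) (auto simp: height_id[THEN ext])
next
  case (snoc d D)
  then obtain J w where J: "J \<subseteq> {r. r < length D \<and> D ! r \<in> A}"
    and w: "w = nths (map (letter n) D) J" "length w = card (inversions m (word_prod w))"
    and h: "\<And>p. height p (word_prod w) = foldl (bubble n A) (\<lambda>x. int (x - p)) D"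
    by auto
  let ?\<sigma> = "word_prod w" and ?a = "letter n d"
  have a: "1 \<le> ?a" "?a < m" using snoc.prems by auto
  have J': "J \<subseteq> {r. r < length (D @ [d]) \<and> (D @ [d]) ! r \<in> A}"
    using J by (auto simp: nth_append)
  have nJ: "length D \<notin> J" using J by auto
  show ?case
  proof (cases "d \<in> A \<and> ?\<sigma> ?a < ?\<sigma> (?a + 1)")
    case True
    let ?J = "insert (length D) J" and ?w = "w @ [?a]"
    have prod: "word_prod ?w = ?\<sigma> \<circ> stp ?a" by (simp add: word_prod_append)
    have "?J \<subseteq> {r. r < length (D @ [d]) \<and> (D @ [d]) ! r \<in> A}" using J' True by auto
    moreover have "?w = nths (map (letter n) (D @ [d])) ?J"
      using nths_insert_length[of "map (letter n) D" J] by (simp add: nths_snoc w(1))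
    moreover have "length ?w = card (inversions m (word_prod ?w))"
      using card_inversions_ascent[of ?a m ?\<sigma>] a True w(2) prod by simp
    moreover have "height p (word_prod ?w) = foldl (bubble n A) (\<lambda>x. int (x - p)) (D @ [d])" for p
    proof -
      obtain b where "?a = Suc b" using a(1) by (cases ?a) auto
      then show ?thesis
        using True a unfolding prod height_stp[OF a(1)]
        by (auto simp: bubble_def h[symmetric] fun_eq_iff)
    qed
    ultimately show ?thesis by blast
  next
    case False
    have "w = nths (map (letter n) (D @ [d])) J"
      using nJ by (simp add: nths_snoc w(1))
    moreover have "height p ?\<sigma> = foldl (bubble n A) (\<lambda>x. int (x - p)) (D @ [d])" for p
    proof -
      obtain b where "?a = Suc b" using a(1) by (cases ?a) auto
      then show ?thesis
        using False by (auto simp: bubble_def h[symmetric] fun_eq_iff)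
    qed
    ultimately show ?thesis using J' w(2) by blast
  qed
qed

text \<open>Greedy heights dominate those of every available subword: using or skipping a letter
  never yields more than the minimum, which is monotone in the neighbouring heights.\<close>

lemma height_subword_le:
  assumes "\<And>d. d \<in> set D \<Longrightarrow> 1 \<le> letter n d" "\<And>r. r \<in> J \<Longrightarrow> r < length D \<Longrightarrow> D ! r \<in> A"
  shows "height p (word_prod (nths (map (letter n) D) J)) x
    \<le> foldl (bubble n A) (\<lambda>x. int (x - p)) D x"
  using assms
proof (induction D arbitrary: x rule: rev_induct)
  case Nil
  then show ?case by (simp add: height_id[unfolded id_def])
next
  case (snoc d D)
  define \<sigma> where "\<sigma> = word_prod (nths (map (letter n) D) J)"
  define h where "h = foldl (bubble n A) (\<lambda>x. int (x - p)) D"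
  let ?a = "letter n d"
  have a: "1 \<le> ?a" using snoc.prems by auto
  have IH: "height p \<sigma> x \<le> h x" for x
    unfolding \<sigma>_def h_def
  proof (rule snoc.IH)
    show "D ! r \<in> A" if "r \<in> J" "r < length D" for r
      using snoc.prems(2)[OF that(1)] that(2) by (simp add: nth_append)
  qed (use snoc.prems(1) in auto)
  have fold: "foldl (bubble n A) (\<lambda>x. int (x - p)) (D @ [d]) = bubble n A h d"
    by (simp add: h_def)
  \<comment> \<open>Consecutive heights differ by 0 or 1; this bounds both the used and the skipped
    letter.\<close>
  have step: "height p \<sigma> ?a \<le> height p \<sigma> (?a - 1) + 1"
      "height p \<sigma> (?a - 1) \<le> height p \<sigma> ?a"
      "height p \<sigma> (?a + 1) = height p \<sigma> ?a + (if p < \<sigma> (?a + 1) then 1 else 0)"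
    using a by (cases ?a; simp)+
  note bounds = IH[of "?a - 1"] IH[of "?a + 1"] step
  show ?case
  proof (cases "length D \<in> J")
    case True
    then have d: "d \<in> A" using snoc.prems(2)[OF True] by simp
    have prod: "word_prod (nths (map (letter n) (D @ [d])) J) = \<sigma> \<circ> stp ?a"
      using True by (simp add: nths_snoc word_prod_append \<sigma>_def)
    have "height p \<sigma> (?a - 1) + (if p < \<sigma> (?a + 1) then 1 else 0)
        \<le> min (h (?a - 1) + 1) (h (?a + 1))"
      using bounds by (cases "p < \<sigma> (?a + 1)") simp_all
    then show ?thesis
      unfolding prod fold height_stp[OF a] using d IH[of x] by (simp add: bubble_def)
  next
    case False
    then have prod: "word_prod (nths (map (letter n) (D @ [d])) J) = \<sigma>"
      by (simp add: nths_snoc \<sigma>_def)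
    have "height p \<sigma> ?a \<le> min (h (?a - 1) + 1) (h (?a + 1))"
      using bounds by (simp split: if_splits)
    then show ?thesis unfolding prod fold using IH[of x] by (simp add: bubble_def)
  qed
qed

section \<open>Heights as longest chains\<close>

text \<open>The predicted height at position n - j + i once rows n, ..., j are read. The last,
  truncated term supplies the height of the identity beyond p, where the chain is empty.\<close>

definition chain_height :: "nat \<Rightarrow> nat \<Rightarrow> (nat \<times> nat) set \<Rightarrow> nat \<Rightarrow> nat \<Rightarrow> int" where
  "chain_height n p A i j = int (n + 1 - j) - int (chain n p A i j) + int (i - p - 1)"

definition row :: "nat \<Rightarrow> (nat \<times> nat) list" where
  "row j = map (\<lambda>i. (i, j)) (rev [1..<j])"

lemma foldl_bubble_part_of_row:
  assumes h: "\<And>i. h (n - j + i) = chain_height n p A (i + 1) (j + 1)"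
    and j: "p < j" "j \<le> n" and c: "1 \<le> c" "c \<le> j"
  shows "foldl (bubble n A) h (map (\<lambda>i. (i, j)) (rev [c..<j])) (n - j + i) =
    (if c \<le> i then chain_height n p A i j else chain_height n p A (i + 1) (j + 1))"
  using c(2,1)
proof (induction c arbitrary: i rule: inc_induct)
  case base
  \<comment> \<open>For i \<ge> j > p both chains are empty and the two predicted heights
    agree.\<close>
  then show ?case using h j by (auto simp: chain_height_def chain_outside)
next
  case (step c)
  let ?h = "foldl (bubble n A) h (map (\<lambda>i. (i, j)) (rev [Suc c..<j]))"
  have IH: "?h (n - j + i) =
    (if Suc c \<le> i then chain_height n p A i j else chain_height n p A (i + 1) (j + 1))" for i
    using step.IH by simp
  have "foldl (bubble n A) h (map (\<lambda>i. (i, j)) (rev [c..<j])) = bubble n A ?h (c, j)"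
    using step.hyps by (simp add: upt_conv_Cons)
  moreover have "bubble n A ?h (c, j) (n - j + i) = ?h (n - j + i)" if "i \<noteq> c"
    using that by (simp add: bubble_def letter_def)
  moreover have "bubble n A ?h (c, j) (n - j + c) = chain_height n p A c j"
  proof (cases "(c, j) \<in> A")
    case True
    \<comment> \<open>The left neighbour still has its value from before row j, while the right
      neighbour is already updated.\<close>
    have "?h (n - j + c - 1) = chain_height n p A c (j + 1)"
      using IH[of "c - 1"] step.prems by (cases c) auto
    moreover have "?h (n - j + c + 1) = chain_height n p A (c + 1) j"
      using IH[of "c + 1"] by simp
    moreover have "min (chain_height n p A c (j + 1) + 1) (chain_height n p A (c + 1) j)
        = chain_height n p A c j"
      using j True chain_available[of c p j n A]
      by (cases "c \<le> p") (auto simp: chain_height_def chain_outside)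
    ultimately show ?thesis using True by (simp add: bubble_def letter_def)
  next
    case False
    moreover have "chain_height n p A (c + 1) (j + 1) = chain_height n p A c j"
      using j False chain_unavailable[of c p j n A]
      by (cases "c \<le> p") (auto simp: chain_height_def chain_outside)
    ultimately show ?thesis using IH[of c] by (simp add: bubble_def)
  qed
  ultimately show ?case using IH[of i] by (cases "i = c") simp_all
qed

text \<open>Position n - j lies left of all letters of row j and is dropped: later rows read only
  positions from n + 1 - j on.\<close>

lemma foldl_bubble_row:
  assumes "\<And>i. h (n - j + i) = chain_height n p A (i + 1) (j + 1)" "p < j" "j \<le> n"
  shows "foldl (bubble n A) h (row j) (n + 1 - j + i) = chain_height n p A (i + 1) j"
  using foldl_bubble_part_of_row[OF assms, of 1 "i + 1"] assms by (simp add: row_def Suc_diff_le)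

lemma foldl_bubble_rows:
  assumes "p < q" "q \<le> n + 1"
  shows "foldl (bubble n A) (\<lambda>x. int (x - p)) (concat (map row (rev [q..<n+1]))) (n + 1 - q + i)
    = chain_height n p A (i + 1) q"
  using assms(2,1)
proof (induction q arbitrary: i rule: inc_induct)
  case base
  then show ?case by (simp add: chain_height_def chain_outside)
next
  case (step q)
  let ?h = "foldl (bubble n A) (\<lambda>x. int (x - p)) (concat (map row (rev [Suc q..<n+1])))"
  have "?h (n - q + i) = chain_height n p A (i + 1) (q + 1)" for i
    using step.IH[of i] step.prems by (simp del: upt_Suc)
  then show ?case
    using foldl_bubble_row[of ?h n q p A i] step.hyps step.prems
    by (simp add: upt_conv_Cons del: upt_Suc)
qed

lemma foldl_bubble_other:
  assumes "\<And>d. d \<in> set D \<Longrightarrow> letter n d \<noteq> x"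
  shows "foldl (bubble n A) h D x = h x"
  using assms by (induction D arbitrary: h) (auto simp: bubble_def)

lemma foldl_bubble_filter:
  assumes "A \<subseteq> B"
  shows "foldl (bubble n A) h (filter (\<lambda>d. d \<in> B) D) = foldl (bubble n A) h D"
  using assms by (induction D arbitrary: h) (auto simp: bubble_def)

lemma diag_list_eq: "diag_list n k = filter (\<lambda>d. d \<in> Gamma n k) (concat (map row (rev [1..<n+1])))"
  by (simp add: diag_list_def row_def filter_concat comp_def)

text \<open>Rows p, ..., 1 contain only letters larger than n - p, so the height at n - p is final
  once row p + 1 has been read.\<close>

lemma foldl_bubble_diag_list:
  assumes "A \<subseteq> Gamma n k" "p \<le> n"
  shows "foldl (bubble n A) (\<lambda>x. int (x - p)) (diag_list n k) (n - p)
    = int (n - p) - int (chain n p A 1 (p + 1))"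
proof -
  have "[1..<n+1] = [1..<p+1] @ [p+1..<n+1]"
    using assms(2) by (metis add_le_cancel_right le_add2 le_add_diff_inverse upt_add_eq_append)
  then have rows: "concat (map row (rev [1..<n+1]))
      = concat (map row (rev [p+1..<n+1])) @ concat (map row (rev [1..<p+1]))" by simp
  have "letter n d \<noteq> n - p" if "d \<in> set (concat (map row (rev [1..<p+1])))" for d
    using that assms(2) by (auto simp: row_def letter_def)
  then have "foldl (bubble n A) (\<lambda>x. int (x - p)) (diag_list n k) (n - p)
      = foldl (bubble n A) (\<lambda>x. int (x - p)) (concat (map row (rev [p+1..<n+1]))) (n - p)"
    unfolding diag_list_eq foldl_bubble_filter[OF assms(1)] rows foldl_append
    by (rule foldl_bubble_other)
  also have "\<dots> = int (n - p) - int (chain n p A 1 (p + 1))"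
    using foldl_bubble_rows[of p "p + 1" n A 0] assms(2)
    by (simp add: chain_height_def del: upt_Suc)
  finally show ?thesis .
qed

section \<open>The word and the list of diagonals\<close>

lemma distinct_diag_list: "distinct (diag_list n k)"
proof -
  have "distinct (concat (map row xs))" if "distinct xs" for xs
    using that by (induction xs) (auto simp: row_def distinct_map inj_on_def)
  then show ?thesis by (simp add: diag_list_eq)
qed

lemma set_diag_list: "set (diag_list n k) = Gamma n k"
  by (auto simp: diag_list_eq row_def Gamma_def image_iff simp del: upt_Suc)

lemma rev_upt_conv_map: "rev [1..<n+1] = map (\<lambda>a. n + 1 - a) [1..<n+1]"
  by (rule nth_equalityI) (auto simp: rev_nth simp del: upt_Suc)

text \<open>Block a of the word is row j = n + 1 - a. The letter is n - (j - i), so the two bounds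
  on j - i that define \<open>Gamma n k\<close> say exactly that the letter lies strictly between k
  and n - k.\<close>

lemma map_letter_row:
  assumes "1 \<le> a" "a \<le> n"
  shows "map (letter n) (filter (\<lambda>d. d \<in> Gamma n k) (row (n + 1 - a)))
    = filter (\<lambda>i. \<not> (1 \<le> i \<and> i \<le> k)) (rev [a..<n - k])"
proof -
  have "map (letter n) (filter (\<lambda>d. d \<in> Gamma n k) (row (n + 1 - a)))
      = map (\<lambda>i. i + (a - 1)) (filter (\<lambda>i. k < i + (a - 1) \<and> i + (a - 1) < n - k) (rev [1..<n + 1 - a]))"
    using assms unfolding row_def filter_map map_map
    by (intro map_cong filter_cong) (auto simp: letter_def Gamma_def)
  also have "\<dots> = filter (\<lambda>i. k < i \<and> i < n - k) (map (\<lambda>i. i + (a - 1)) (rev [1..<n + 1 - a]))"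
    by (simp add: filter_map comp_def)
  also have "map (\<lambda>i. i + (a - 1)) (rev [1..<n + 1 - a]) = rev [a..<n]"
  proof -
    have "map (\<lambda>i. i + (a - 1)) [1..<n + 1 - a] = [a..<n]"
      by (rule nth_equalityI) (use assms in auto)
    then show ?thesis by (metis rev_map)
  qed
  also have "filter (\<lambda>i. k < i \<and> i < n - k) (rev [a..<n])
      = filter (\<lambda>i. \<not> (1 \<le> i \<and> i \<le> k)) (rev [a..<n - k])"
  proof (cases "a \<le> n - k")
    case True
    then have "[a..<n] = [a..<n - k] @ [n - k..<n]"
      by (metis diff_le_self le_add_diff_inverse upt_add_eq_append)
    then show ?thesis using assms
      by (auto simp: rev_filter[symmetric] filter_empty_conv intro!: filter_cong)
  next
    case False
    then show ?thesis by (auto simp: filter_empty_conv)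
  qed
  finally show ?thesis .
qed

lemma Q'_word_eq: "Q'_word n k = map (letter n) (diag_list n k)"
proof -
  let ?P = "\<lambda>i. \<not> (1 \<le> i \<and> i \<le> k)"
  have "map (letter n) (diag_list n k)
      = concat (map (\<lambda>a. map (letter n) (filter (\<lambda>d. d \<in> Gamma n k) (row (n + 1 - a)))) [1..<n+1])"
    unfolding diag_list_eq rev_upt_conv_map by (simp add: filter_concat map_concat comp_def)
  also have "\<dots> = concat (map (\<lambda>a. filter ?P (rev [a..<n - k])) [1..<n+1])"
    by (intro arg_cong[of _ _ concat] map_cong refl map_letter_row) auto
  \<comment> \<open>Blocks with a \<ge> n - k are empty.\<close>
  also have "\<dots> = concat (map (\<lambda>a. filter ?P (rev [a..<n - k])) [1..<n - k])"
  proof (cases "1 \<le> n - k")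
    case True
    then have "[1..<n+1] = [1..<n - k] @ [n - k..<n+1]"
      by (metis diff_le_self le_add_diff_inverse upt_add_eq_append trans_le_add1)
    then show ?thesis by (auto simp: concat_eq_Nil_conv simp del: upt_Suc)
  next
    case False
    then show ?thesis by auto
  qed
  finally show ?thesis by (simp add: Q'_word_def Q_word_def filter_concat comp_def)
qed

lemma letter_bounds: "d \<in> Gamma n k \<Longrightarrow> k < letter n d \<and> letter n d < n - k"
  by (auto simp: Gamma_def letter_def)

section \<open>Subwords for the permutation\<close>

lemma height_pi_nk:
  assumes "k \<le> p" "p \<le> n"
  shows "height p (pi_nk n k) (n - p) = int (n - p - k)"
proof -
  have "height p (pi_nk n k) x = int (x - k)" if "x \<le> n - p" for x
    using that assms by (induction x) (auto simp: pi_nk_def)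
  then show ?thesis by simp
qed

text \<open>The heights bound each entry after position k from below by its value in
  \<open>pi_nk n k\<close>; injectivity then forces equality from left to right.\<close>

lemma eq_pi_nk:
  assumes inj: "inj \<sigma>" and fixed: "\<And>x. x \<le> k \<or> n - k < x \<Longrightarrow> \<sigma> x = x"
    and height: "\<And>p. k < p \<Longrightarrow> p \<le> n \<Longrightarrow> height p \<sigma> (n - p) \<ge> int (n - p) - int k"
  shows "\<sigma> = pi_nk n k"
proof
  fix x
  have range: "k < \<sigma> y \<and> \<sigma> y \<le> n - k" if "k < y" "y \<le> n - k" for y
  proof (rule ccontr)
    assume out: "\<not> ?thesis"
    then have "\<sigma> (\<sigma> y) = \<sigma> y" by (intro fixed) auto
    then have "\<sigma> y = y" using inj by (simp add: inj_eq)
    then show False using that out by simp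
  qed
  \<comment> \<open>The bound comes from p = n - y. For y = n - k this would be p = k, which the
    height hypothesis does not cover, so \<open>range\<close> is used there.\<close>
  have ge: "n + 1 - y \<le> \<sigma> y" if y: "k < y" "y \<le> n - k" for y
  proof (cases "y = n - k")
    case True
    then show ?thesis using range[OF y] y by linarith
  next
    case False
    then have "n - y < \<sigma> y"
      using y height[of "n - y"] fixed by (intro height_full[of k \<sigma> "n - y" y]) auto
    then show ?thesis by simp
  qed
  have eq: "\<sigma> y = n + 1 - y" if "k < y" "y \<le> n - k" for y
    using that
  proof (induction y rule: less_induct)
    case (less y)
    show ?case
    proof (rule ccontr)
      assume neq: "\<sigma> y \<noteq> n + 1 - y"
      \<comment> \<open>If the entry at y were too large, its value would already be taken at the
        earlier position \<open>?z\<close>.\<close>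
      let ?z = "n + 1 - \<sigma> y"
      have z: "?z < y" "k < ?z" "n + 1 - ?z = \<sigma> y"
        using neq ge[OF less.prems] range[OF less.prems] less.prems by auto
      then have "\<sigma> ?z = \<sigma> y" using less.IH[of ?z] less.prems by simp
      then show False using inj z(1) by (simp add: inj_eq)
    qed
  qed
  show "\<sigma> x = pi_nk n k x"
    using eq[of x] fixed[of x] by (auto simp: pi_nk_def)
qed

text \<open>A subword for the permutation needs height n - p - k at n - p, while the greedy maximum
  is n - p minus the longest chain. If all chains are at most k, the greedy subword itself attains
  the permutation.\<close>

lemma subword_iff_crossing_free:
  assumes "F \<subseteq> Gamma n k"
  shows "(\<exists>J \<subseteq> {r. r < length (diag_list n k) \<and> diag_list n k ! r \<notin> F}.
      reduced_word (n - k) (nths (Q'_word n k) J) (pi_nk n k)) \<longleftrightarrow> crossing_free k F"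
    (is "?L \<longleftrightarrow> ?R")
proof
  let ?D = "diag_list n k" and ?A = "Gamma n k - F"
  assume ?L
  then obtain J where J: "J \<subseteq> {r. r < length ?D \<and> ?D ! r \<notin> F}"
    and prod: "word_prod (nths (map (letter n) ?D) J) = pi_nk n k"
    by (auto simp: reduced_word_def Q'_word_eq)
  have "chain n p ?A 1 (p + 1) \<le> k" if p: "k < p" "p \<le> n" for p
  proof -
    have "height p (pi_nk n k) (n - p) \<le> foldl (bubble n ?A) (\<lambda>x. int (x - p)) ?D (n - p)"
      unfolding prod[symmetric]
    proof (rule height_subword_le)
      show "1 \<le> letter n d" if "d \<in> set ?D" for d
        using that letter_bounds[of d n k] by (simp add: set_diag_list)
      show "?D ! r \<in> ?A" if "r \<in> J" "r < length ?D" for r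
        using that J nth_mem[of r ?D] by (auto simp: set_diag_list)
    qed
    \<comment> \<open>If n - p < k, the required height truncates to 0 and the chain is at most n -
      p.\<close>
    then show ?thesis
      using p height_pi_nk[of k p n] foldl_bubble_diag_list[of ?A n k p] by simp
  qed
  then show ?R using crossing_free_iff_chain_le[OF assms] by blast
next
  let ?D = "diag_list n k" and ?A = "Gamma n k - F"
  assume ?R
  have letters: "k < letter n d \<and> letter n d < n - k" if "d \<in> set ?D" for d
    using that letter_bounds[of d n k] by (simp add: set_diag_list)
  then have "1 \<le> letter n d \<and> letter n d < n - k" if "d \<in> set ?D" for d
    using that by fastforce
  from greedy_word[OF this, of ?D ?A] obtain J w
    where J: "J \<subseteq> {r. r < length ?D \<and> ?D ! r \<in> ?A}"
    and w: "w = nths (map (letter n) ?D) J" "length w = card (inversions (n - k) (word_prod w))"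
    and h: "\<And>p. height p (word_prod w) = foldl (bubble n ?A) (\<lambda>x. int (x - p)) ?D"
    by blast
  have set_w: "k < a \<and> a < n - k" if "a \<in> set w" for a
    using that letters set_nths_subset[of "map (letter n) ?D" J] by (auto simp: w(1))
  have "word_prod w = pi_nk n k"
  proof (rule eq_pi_nk)
    show "word_prod w x = x" if "x \<le> k \<or> n - k < x" for x
      using word_prod_fixed[OF set_w that] .
    show "height p (word_prod w) (n - p) \<ge> int (n - p) - int k" if "k < p" "p \<le> n" for p
      using that \<open>?R\<close> crossing_free_iff_chain_le[OF assms] foldl_bubble_diag_list[of ?A n k p]
      by (simp add: h)
  qed (rule inj_word_prod)
  moreover have "is_word (n - k) w"
    using set_w by (fastforce simp: is_word_def)
  \<comment> \<open>The inversion number depends only on the product, equals the length of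
    \<open>w\<close>, and bounds every competing word from below.\<close>
  moreover have "length w \<le> length w'" if "is_word (n - k) w'" "word_prod w' = word_prod w" for w'
    using card_inversions_le_length[of w' "n - k"] that w(2) by (simp add: is_word_def)
  ultimately have "reduced_word (n - k) w (pi_nk n k)" by (auto simp: reduced_word_def)
  moreover have "J \<subseteq> {r. r < length ?D \<and> ?D ! r \<notin> F}" using J by auto
  ultimately show ?L by (auto simp: Q'_word_eq w(1))
qed

theorem theorem2p1:
  fixes n k :: nat
  assumes "1 \<le> k" and "2 * k + 1 \<le> n"
  shows "length (Q'_word n k) = length (diag_list n k)
    \<and> bij_betw (\<lambda>p. diag_list n k ! p) {0..<length (Q'_word n k)} (Gamma n k)
    \<and> (\<forall>p < length (Q'_word n k).
         Q'_word n k ! p = n - snd (diag_list n k ! p) + fst (diag_list n k ! p))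
    \<and> Delta_faces n k =
        (\<lambda>I. (\<lambda>p. diag_list n k ! p) ` I) ` subword_faces (n - k) (Q'_word n k) (pi_nk n k)"
proof -
  let ?D = "diag_list n k" and ?Q = "Q'_word n k"
  have len: "length ?Q = length ?D" by (simp add: Q'_word_eq)
  have bij: "bij_betw (\<lambda>p. ?D ! p) {0..<length ?Q} (Gamma n k)"
    using bij_betw_nth[OF distinct_diag_list, of "{0..<length ?Q}" n k "Gamma n k"]
    by (simp add: len set_diag_list atLeast0LessThan)
  have face: "I \<in> subword_faces (n - k) ?Q (pi_nk n k) \<longleftrightarrow> crossing_free k ((!) ?D ` I)"
    if I: "I \<subseteq> {0..<length ?Q}" for I
  proof -
    \<comment> \<open>As the enumeration has no repetitions, the positions outside I are exactly
      those whose diagonals are outside the image of I.\<close>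
    have "{0..<length ?Q} - I = {r. r < length ?D \<and> ?D ! r \<notin> (!) ?D ` I}"
      using I distinct_diag_list[of n k] by (auto simp: len nth_eq_iff_index_eq subset_iff)
    moreover have "(!) ?D ` I \<subseteq> Gamma n k"
      using I bij by (auto simp: bij_betw_def)
    ultimately show ?thesis
      using I subword_iff_crossing_free[of "(!) ?D ` I" n k] by (auto simp: subword_faces_def)
  qed
  have "Delta_faces n k = (\<lambda>I. (\<lambda>p. ?D ! p) ` I) ` subword_faces (n - k) ?Q (pi_nk n k)"
  proof (intro equalityI subsetI)
    fix F assume "F \<in> Delta_faces n k"
    then have F: "F \<subseteq> Gamma n k" "crossing_free k F" by (auto simp: Delta_faces_eq)
    then obtain I where "I \<subseteq> {0..<length ?Q}" "F = (!) ?D ` I"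
      using bij by (metis bij_betw_def subset_image_iff)
    then show "F \<in> (\<lambda>I. (\<lambda>p. ?D ! p) ` I) ` subword_faces (n - k) ?Q (pi_nk n k)"
      using face F(2) by blast
  next
    fix F assume "F \<in> (\<lambda>I. (\<lambda>p. ?D ! p) ` I) ` subword_faces (n - k) ?Q (pi_nk n k)"
    then obtain I where I: "I \<in> subword_faces (n - k) ?Q (pi_nk n k)" "F = (!) ?D ` I" by blast
    then have "I \<subseteq> {0..<length ?Q}" by (simp add: subword_faces_def)
    then show "F \<in> Delta_faces n k"
      using I face bij by (auto simp: Delta_faces_eq bij_betw_def)
  qed
  then show ?thesis using len bij by (simp add: Q'_word_eq letter_def)
qed

end
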